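(* Let $\mathcal D$ be a doctrine on a finite set of literals $\Pi$ and let $v$ be a valuation. The upper revised valuation $v^*$ of $v$ with respect to $\mathcal D$ is the lowest of the valuations $w$ that satisfy $v\le w$ and $w'=w$; that is, $v\le v^*$, $(v^* )'=v^*$, and every valuation $w$ with $v\le w$ and $w'=w$ satisfies $v^*\le w$.
   Context: $\Pi_+$ is a finite nonempty set of atoms; $\Pi=\bigcup_{p\in\Pi_+}\{p,\overline p\}$ is the set of literals, where $p\mapsto\overline p$ is negation and $\overline{\overline p}=p$. A clause is a subset $C\subseteq\Pi$, read as the disjunction $\bigvee_{p\in C}p$. A doctrine is a collection $\mathcal D$ of clauses, read as the conjunctive normal form $\bigwedge_{C\in\mathcal D}\bigvee_{p\in C}p$. Standing assumptions: (D1) this formula is satisfiable; (D2) no clause in $\mathcal D$ consists of a single literal; (D3) $\{p,\overline p\}\in\mathcal D$ for every $p\in\Pi_+$. A valuation is a map $w:\Pi\to[0,1]$, $p\mapsto w_p$; $v\le w$ means $v_p\le w_p$ for all $p\in\Pi$. For a valuation $v$ define $v'$ by $$v'_p=\max_{C\in\mathcal D,\ C\ni p}\ \min_{\alpha\in C,\ \alpha\neq p} v_{\overline\alpha}.$$ Put $v^{(0)}=v$ and $v^{(n+1)}=(v^{(n)})'$. This sequence is non-decreasing and takes values in the finite set $\{v_\alpha:\alpha\in\Pi\}$, so it is eventually constant; its eventual value is the upper revised valuation $v^*$. *)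

theory Defs
  imports Complex_Main
begin

text \<open>
  The finite nonempty set of atoms is the universe of a type \<open>'a\<close> of class \<open>finite\<close>, so that the
  set of literals is the universe of \<open>'a literal\<close>.
\<close>

datatype 'a literal = Pos 'a | Neg 'a

fun neg :: "'a literal \<Rightarrow> 'a literal" where
  "neg (Pos a) = Neg a"
| "neg (Neg a) = Pos a"

instance literal :: (finite) finite
proof
  have "(UNIV :: 'a literal set) = range Pos \<union> range Neg"
    by (metis (no_types) UNIV_eq_I Un_iff literal.exhaust rangeI)
  then show "finite (UNIV :: 'a literal set)"
    by (metis finite finite_Un finite_imageI)
qed

type_synonym 'a clause = "'a literal set"

fun holds :: "('a \<Rightarrow> bool) \<Rightarrow> 'a literal \<Rightarrow> bool" where
  "holds \<tau> (Pos a) \<longleftrightarrow> \<tau> a"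
| "holds \<tau> (Neg a) \<longleftrightarrow> \<not> \<tau> a"

definition satisfiable :: "'a clause set \<Rightarrow> bool" where
  "satisfiable D \<longleftrightarrow> (\<exists>\<tau>. \<forall>C\<in>D. \<exists>p\<in>C. holds \<tau> p)"

definition doctrine :: "'a clause set \<Rightarrow> bool" where
  "doctrine D \<longleftrightarrow>
     satisfiable D \<and>
     (\<forall>p. {p} \<notin> D) \<and>
     (\<forall>a. {Pos a, neg (Pos a)} \<in> D)"

definition valuation :: "('a literal \<Rightarrow> real) \<Rightarrow> bool" where
  "valuation v \<longleftrightarrow> (\<forall>p. 0 \<le> v p \<and> v p \<le> 1)"

text \<open>
  For a doctrine over a finite type of atoms, the \<open>Max\<close> and \<open>Min\<close> below range over finite nonempty
  sets: every literal lies in a clause \<open>{p, neg p}\<close>, and no clause is a singleton.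
\<close>

definition revise :: "'a clause set \<Rightarrow> ('a literal \<Rightarrow> real) \<Rightarrow> 'a literal \<Rightarrow> real" where
  "revise D v p = Max {Min {v (neg \<alpha>) |\<alpha>. \<alpha> \<in> C \<and> \<alpha> \<noteq> p} |C. C \<in> D \<and> p \<in> C}"

text \<open>The eventual value of the sequence of iterated revisions of \<open>v\<close>.\<close>

definition upper_revised :: "'a clause set \<Rightarrow> ('a literal \<Rightarrow> real) \<Rightarrow> 'a literal \<Rightarrow> real" where
  "upper_revised D v = (THE w. \<exists>N. \<forall>n\<ge>N. (revise D ^^ n) v = w)"

end

theory Submission
  imports Defs "HOL-Library.FuncSet"
begin

text \<open>
  The clause \<open>{p, neg p}\<close> makes revision inflationary, and revision is monotone and invents no new
  values. Hence the iterates of \<open>v\<close> form an increasing sequence in a finite set of functions and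
  stabilise; by monotonicity, every fixed point above \<open>v\<close> stays above all iterates.
\<close>

lemma neg_neg [simp]: "neg (neg p) = p"
  by (cases p) auto

lemma doctrine_complement_clause: "doctrine D \<Longrightarrow> {p, neg p} \<in> D"
  by (cases p) (auto simp: doctrine_def insert_commute)

lemma doctrine_other_literal:
  assumes "doctrine D" "C \<in> D" "p \<in> C"
  obtains \<alpha> where "\<alpha> \<in> C" "\<alpha> \<noteq> p"
proof -
  have "C \<noteq> {p}"
    using assms(1,2) by (auto simp: doctrine_def)
  then show thesis
    using assms(3) that by blast
qed

text \<open>A maximum reaches \<open>x\<close> iff some member does, a minimum iff every member
  does. In this threshold form, a lower bound on a revised value is proved by exhibiting one
  clause.\<close>

lemma le_revise_iff:
  fixes D :: "'a::finite clause set"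
  assumes "doctrine D"
  shows "x \<le> revise D v p \<longleftrightarrow> (\<exists>C\<in>D. p \<in> C \<and> (\<forall>\<alpha>\<in>C. \<alpha> \<noteq> p \<longrightarrow> x \<le> v (neg \<alpha>)))"
proof -
  let ?S = "\<lambda>C. {v (neg \<alpha>) |\<alpha>. \<alpha> \<in> C \<and> \<alpha> \<noteq> p}"
  have "x \<le> revise D v p \<longleftrightarrow> (\<exists>m\<in>{Min (?S C) |C. C \<in> D \<and> p \<in> C}. x \<le> m)"
    unfolding revise_def
    by (rule Max_ge_iff) (use doctrine_complement_clause[OF assms] in auto)
  also have "\<dots> \<longleftrightarrow> (\<exists>C\<in>D. p \<in> C \<and> x \<le> Min (?S C))"
    by blast
  also have "\<dots> \<longleftrightarrow> (\<exists>C\<in>D. p \<in> C \<and> (\<forall>\<alpha>\<in>C. \<alpha> \<noteq> p \<longrightarrow> x \<le> v (neg \<alpha>)))"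
  proof (rule bex_cong[OF refl], rule conj_cong[OF refl])
    fix C assume C: "C \<in> D" "p \<in> C"
    \<comment> \<open>This is where the exclusion of singleton clauses enters: \<open>Min\<close>
      needs a nonempty set.\<close>
    have "?S C \<noteq> {}"
      using doctrine_other_literal[OF assms C] by blast
    then show "x \<le> Min (?S C) \<longleftrightarrow> (\<forall>\<alpha>\<in>C. \<alpha> \<noteq> p \<longrightarrow> x \<le> v (neg \<alpha>))"
      by (subst Min_ge_iff) auto
  qed
  finally show ?thesis .
qed

lemma revise_increasing:
  fixes D :: "'a::finite clause set"
  assumes "doctrine D"
  shows "v \<le> revise D v"
proof (rule le_funI)
  fix p
  \<comment> \<open>In \<open>{p, neg p}\<close> the only literal other than \<open>p\<close> is
    \<open>neg p\<close>, whose negation is \<open>p\<close> again, so this clause contributes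
    exactly \<open>v p\<close>.\<close>
  show "v p \<le> revise D v p"
    unfolding le_revise_iff[OF assms]
    by (rule bexI[OF _ doctrine_complement_clause[OF assms, of p]]) auto
qed

lemma mono_revise:
  fixes D :: "'a::finite clause set"
  assumes "doctrine D"
  shows "mono (revise D)"
proof (intro monoI le_funI)
  fix u w :: "'a literal \<Rightarrow> real" and p
  assume "u \<le> w"
  \<comment> \<open>Taking the revised value itself as threshold yields a clause attaining the
    maximum for \<open>u\<close>; the same clause serves as witness for \<open>w\<close>.\<close>
  moreover obtain C where "C \<in> D" "p \<in> C" "\<forall>\<alpha>\<in>C. \<alpha> \<noteq> p \<longrightarrow> revise D u p \<le> u (neg \<alpha>)"
    using le_revise_iff[OF assms, of "revise D u p" u p] by blast
  ultimately show "revise D u p \<le> revise D w p"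
    unfolding le_revise_iff[OF assms, of _ w] by (meson le_funD order_trans)
qed

text \<open>Maxima and minima of finite nonempty sets are attained, so each revised value is some
  \<open>v (neg \<alpha>)\<close>.\<close>

lemma range_revise_subset:
  fixes D :: "'a::finite clause set"
  assumes "doctrine D"
  shows "range (revise D v) \<subseteq> range v"
proof (rule image_subsetI)
  fix p
  let ?S = "\<lambda>C. {v (neg \<alpha>) |\<alpha>. \<alpha> \<in> C \<and> \<alpha> \<noteq> p}"
  have "revise D v p \<in> {Min (?S C) |C. C \<in> D \<and> p \<in> C}"
    unfolding revise_def
    by (rule Max_in) (use doctrine_complement_clause[OF assms] in auto)
  then obtain C where C: "C \<in> D" "p \<in> C" "revise D v p = Min (?S C)"
    by blast
  have "Min (?S C) \<in> ?S C"
    by (rule Min_in) (use doctrine_other_literal[OF assms C(1,2)] in auto)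
  then show "revise D v p \<in> range v"
    using C(3) by auto
qed

lemma range_iterate_revise_subset:
  fixes D :: "'a::finite clause set"
  assumes "doctrine D"
  shows "range ((revise D ^^ n) v) \<subseteq> range v"
  by (induction n) (use range_revise_subset[OF assms] in \<open>simp, fastforce\<close>)

lemma incseq_finite_range_eventually_const:
  fixes X :: "nat \<Rightarrow> 'b::order"
  assumes "incseq X" "finite (range X)"
  obtains N where "\<And>n. n \<ge> N \<Longrightarrow> X n = X N"
proof -
  \<comment> \<open>\<open>X N\<close> is a maximal element of the range; later terms lie above it
    and hence equal it.\<close>
  obtain N where "\<And>n. X N \<le> X n \<Longrightarrow> X N = X n"
    using finite_has_maximal[OF assms(2)] by auto
  then show thesis
    using that incseqD[OF assms(1)] by metis
qed

lemma upper_revised_eq_iterate: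
  fixes D :: "'a::finite clause set"
  assumes "doctrine D"
  obtains N where "upper_revised D v = (revise D ^^ N) v"
    and "revise D (upper_revised D v) = upper_revised D v"
proof -
  let ?X = "\<lambda>n. (revise D ^^ n) v"
  have "incseq ?X"
    by (rule incseq_SucI) (simp add: revise_increasing[OF assms])
  moreover have "finite (range ?X)"
  proof (rule finite_subset)
    \<comment> \<open>Extensionality over \<open>UNIV\<close> is vacuous, so these are all functions
      from the finitely many literals into the finite set \<open>range v\<close>.\<close>
    show "range ?X \<subseteq> UNIV \<rightarrow>\<^sub>E range v"
      using range_iterate_revise_subset[OF assms] by (fastforce simp: PiE_def)
    show "finite ((UNIV :: 'a literal set) \<rightarrow>\<^sub>E range v)"
      by (rule finite_PiE) auto
  qed
  ultimately obtain N where N: "\<And>n. n \<ge> N \<Longrightarrow> ?X n = ?X N"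
    using incseq_finite_range_eventually_const by blast
  have "upper_revised D v = ?X N"
    unfolding upper_revised_def
  proof (rule the_equality)
    show "\<exists>M. \<forall>n\<ge>M. ?X n = ?X N"
      using N by blast
  next
    fix w assume "\<exists>M. \<forall>n\<ge>M. ?X n = w"
    then obtain M where "\<forall>n\<ge>M. ?X n = w" ..
    then show "w = ?X N"
      \<comment> \<open>At index \<open>max M N\<close> both eventual values are in force, so they
        coincide.\<close>
      using N[of "max M N"] by simp
  qed
  moreover have "revise D (?X N) = ?X N"
    using N[of "Suc N"] by simp
  ultimately show thesis
    using that by simp
qed

theorem theorem3p3:
  fixes D :: "'a::finite clause set"
    and v :: "'a literal \<Rightarrow> real"
  assumes "doctrine D"
    and "valuation v"
  shows "valuation (upper_revised D v) \<and>
    v \<le> upper_revised D v \<and>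
    revise D (upper_revised D v) = upper_revised D v \<and>
    (\<forall>w. valuation w \<and> v \<le> w \<and> revise D w = w \<longrightarrow> upper_revised D v \<le> w)"
proof -
  obtain N where N: "upper_revised D v = (revise D ^^ N) v"
    and fixpoint: "revise D (upper_revised D v) = upper_revised D v"
    using upper_revised_eq_iterate[OF assms(1)] .
  \<comment> \<open>The bounds 0 and 1 carry over because every value of the limit is already a
    value of \<open>v\<close>.\<close>
  have "upper_revised D v p \<in> range v" for p
    using range_iterate_revise_subset[OF assms(1), of N v] unfolding N by blast
  then have "valuation (upper_revised D v)"
    using assms(2) unfolding valuation_def by (metis imageE)
  moreover have "v \<le> (revise D ^^ n) v" for n
    by (induction n) (auto intro: order_trans revise_increasing[OF assms(1)])
  moreover have "(revise D ^^ n) v \<le> w" if "v \<le> w" "revise D w = w" for n w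
    using that by (induction n) (simp, metis funpow.simps(2) comp_apply monoD mono_revise[OF assms(1)])
  ultimately show ?thesis
    using N fixpoint by simp
qed

end
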